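(* Any connected graph $G$ with $\mathrm{QEC}(G)<-1/2$ does not contain an induced subgraph isomorphic to a diamond $K_4\backslash\{e\}$, a claw $K_{1,3}$, a cycle $C_4$, nor a cycle $C_5$. In short, any connected graph $G$ with $\mathrm{QEC}(G)<-1/2$ is diamond-free, claw-free, $C_4$-free and $C_5$-free.
   Context: All graphs are finite, simple and undirected. The diamond $K_4\backslash\{e\}$ is the graph obtained by deleting one edge from the complete graph $K_4$; the claw $K_{1,3}$ is the complete bipartite graph with parts of sizes $1$ and $3$; $C_n$ is the cycle on $n$ vertices. A graph is $H$-free if it has no induced subgraph isomorphic to $H$. For a connected graph $G=(V,E)$ with $|V|\ge2$, $d(i,j)$ denotes the length of a shortest walk connecting $i$ and $j$ (with $d(i,i)=0$), and $D=[d(i,j)]_{i,j\in V}$ is the distance matrix. $C(V)$ is the space of real-valued functions on $V$, $\langle\cdot,\cdot\rangle$ its canonical inner product, and $\mathbf 1$ the constant function with value $1$. The quadratic embedding constant of $G$ (defined only for connected graphs with at least two vertices, so $G$ is understood to have at least two vertices) is $$\mathrm{QEC}(G)=\max\{\langle f,Df\rangle : f\in C(V),\ \langle f,f\rangle=1,\ \langle \mathbf 1,f\rangle=0\}.$$ *)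

theory Defs
  imports "HOL-Analysis.Analysis" "Graph_Theory.Graph_Theory"
begin

text \<open>
  A finite simple undirected graph is a \<^term>\<open>pair_graph\<close>: an edge between
  \<open>u\<close> and \<open>v\<close> is represented by the two arcs \<open>(u, v)\<close> and \<open>(v, u)\<close>.
\<close>

definition has_induced_copy :: "'a pair_pre_digraph \<Rightarrow> 'b pair_pre_digraph \<Rightarrow> bool" where
  "has_induced_copy G H \<longleftrightarrow>
     (\<exists>K. induced_subgraph K (with_proj G) \<and> digraph_iso K (with_proj H))"

definition graph_free :: "'b pair_pre_digraph \<Rightarrow> 'a pair_pre_digraph \<Rightarrow> bool" where
  "graph_free H G \<longleftrightarrow> \<not> has_induced_copy G H"

definition complete_graph :: "nat \<Rightarrow> nat pair_pre_digraph" where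
  "complete_graph n = \<lparr> pverts = {..<n}, parcs = {(i, j). i < n \<and> j < n \<and> i \<noteq> j} \<rparr>"

definition complete_bipartite_graph :: "nat \<Rightarrow> nat \<Rightarrow> nat pair_pre_digraph" where
  "complete_bipartite_graph m n =
     \<lparr> pverts = {..<m + n},
       parcs = {..<m} \<times> {m..<m + n} \<union> {m..<m + n} \<times> {..<m} \<rparr>"

text \<open>Only meaningful for \<open>n \<ge> 3\<close>; for \<open>n = 1\<close> it is a loop.\<close>

definition cycle_graph :: "nat \<Rightarrow> nat pair_pre_digraph" where
  "cycle_graph n =
     \<lparr> pverts = {..<n},
       parcs = (\<Union>i<n. {(i, Suc i mod n), (Suc i mod n, i)}) \<rparr>"

definition diamond :: "nat pair_pre_digraph" where
  "diamond = \<lparr> pverts = pverts (complete_graph 4),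
               parcs = parcs (complete_graph 4) - {(0, 1), (1, 0)} \<rparr>"

definition claw :: "nat pair_pre_digraph" where
  "claw = complete_bipartite_graph 1 3"

text \<open>
  With unit arc weights, \<^const>\<open>wf_digraph.\<mu>\<close> is the infimum of the lengths of the
  walks from \<open>i\<close> to \<open>j\<close>. It is finite when \<open>G\<close> is connected.
\<close>

definition graph_dist :: "'a pair_pre_digraph \<Rightarrow> 'a \<Rightarrow> 'a \<Rightarrow> real" where
  "graph_dist G i j = real_of_ereal (wf_digraph.\<mu> (with_proj G) (\<lambda>_. 1) i j)"

text \<open>
  Real functions on the vertex set \<open>V\<close> are represented by functions on the whole type, of
  which only the values on \<open>V\<close> are used.
\<close>

definition inner_on :: "'a set \<Rightarrow> ('a \<Rightarrow> real) \<Rightarrow> ('a \<Rightarrow> real) \<Rightarrow> real" where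
  "inner_on V f g = (\<Sum>i\<in>V. f i * g i)"

definition dist_matrix_apply :: "'a pair_pre_digraph \<Rightarrow> ('a \<Rightarrow> real) \<Rightarrow> 'a \<Rightarrow> real" where
  "dist_matrix_apply G f i = (\<Sum>j\<in>pverts G. graph_dist G i j * f j)"

text \<open>
  \<^const>\<open>Max\<close> is reserved for finite sets, so the maximum is expressed by \<^const>\<open>Greatest\<close>. It is
  attained for connected \<open>G\<close> with at least two vertices, since a continuous function is then
  maximised over a nonempty compact set.
\<close>

definition QEC :: "'a pair_pre_digraph \<Rightarrow> real" where
  "QEC G = (GREATEST q. \<exists>f. q = inner_on (pverts G) f (dist_matrix_apply G f) \<and>
                             inner_on (pverts G) f f = 1 \<and>
                             inner_on (pverts G) (\<lambda>_. 1) f = 0)"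

end

theory Submission
  imports Defs
begin

text \<open>
  For a nonzero function \<open>f\<close> on \<open>V\<close> with \<open>\<langle>\<one>,f\<rangle> = 0\<close>, the quotient
  \<open>\<langle>f,Df\<rangle> / \<langle>f,f\<rangle>\<close> is a lower bound of \<open>QEC(G)\<close> (\<open>QEC_rayleigh_bound\<close>), so it suffices to
  find, for each of the four graphs \<open>H\<close>, a test function supported on the induced copy of \<open>H\<close> whose
  quotient is at least \<open>-1/2\<close>.

  Each of the four graphs has diameter two. Hence two vertices of the copy that are not adjacent
  have a common neighbour, their distance in \<open>G\<close> is again two, and the distances in \<open>G\<close> between
  vertices of the copy are those in \<open>H\<close>: there \<open>D = 2J - 2I - A\<close>, where \<open>A\<close> is the adjacency matrix
  of \<open>H\<close> and \<open>J\<close> the all-ones matrix. For a function \<open>x\<close> on \<open>H\<close> with sum zero the term of \<open>J\<close>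
  vanishes and \<open>\<langle>x,Dx\<rangle> = -2\<langle>x,x\<rangle> - \<langle>x,Ax\<rangle>\<close> (\<open>QEC_ge_of_induced_diameter_two\<close>). So \<open>H\<close> is
  excluded as soon as \<open>\<langle>x,Ax\<rangle> \<le> -3/2 \<langle>x,x\<rangle>\<close> for some such \<open>x \<noteq> 0\<close>
  (\<open>graph_free_if_QEC_less\<close>), which is checked on one explicit integer vector for each graph.
\<close>

section \<open>The quadratic embedding constant is an attained maximum\<close>

lemma continuous_on_dist_form:
  "continuous_on S (\<lambda>f. inner_on V f (dist_matrix_apply G f))"
  unfolding inner_on_def dist_matrix_apply_def
  by (intro continuous_intros continuous_on_subset[OF continuous_on_product_coordinates]) auto

text \<open>
  Setting the functions to zero off \<open>V\<close> puts them into a product of compact intervals and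
  singletons, indexed by the whole type, which is compact by Tychonoff's theorem.
\<close>

lemma compact_unit_sphere_sum_zero:
  assumes "finite V"
  shows "compact {f :: 'a \<Rightarrow> real. (\<forall>i. i \<notin> V \<longrightarrow> f i = 0) \<and>
           inner_on V f f = 1 \<and> inner_on V (\<lambda>_. 1) f = 0}" (is "compact ?S")
proof -
  let ?B = "Pi\<^sub>E UNIV (\<lambda>i. if i \<in> V then {-1..1} else {0 :: real})"
  have "compact ?B"
    by (subst compactin_euclidean_iff[symmetric], subst euclidean_product_topology[symmetric])
      (auto simp: compactin_PiE)
  moreover have "closed {f :: 'a \<Rightarrow> real. inner_on V f f = 1 \<and> inner_on V (\<lambda>_. 1) f = 0}"
    unfolding inner_on_def
    by (intro closed_Collect_conj closed_Collect_eq continuous_intros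
        continuous_on_product_coordinates)
  moreover have "?S = ?B \<inter> {f. inner_on V f f = 1 \<and> inner_on V (\<lambda>_. 1) f = 0}"
  proof -
    have "\<bar>f i\<bar> \<le> 1" if "inner_on V f f = 1" "i \<in> V" for f :: "'a \<Rightarrow> real" and i
    proof -
      have "(f i)\<^sup>2 \<le> inner_on V f f"
        unfolding inner_on_def power2_eq_square
        using that assms by (intro member_le_sum) auto
      then show ?thesis
        using that by (simp add: abs_square_le_1)
    qed
    then show ?thesis
      by (fastforce simp: abs_le_iff PiE_iff split: if_splits)
  qed
  ultimately show ?thesis
    by (simp add: compact_Int_closed)
qed

text \<open>
  A value defined by \<^const>\<open>Greatest\<close> bounds the others only if a greatest one exists. Here the
  form is continuous and attains its maximum on the compact set above.
\<close>

lemma QEC_upper_bound: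
  assumes fin: "finite (pverts G)"
    and norm: "inner_on (pverts G) h h = 1"
    and sum0: "inner_on (pverts G) (\<lambda>_. 1) h = 0"
  shows "inner_on (pverts G) h (dist_matrix_apply G h) \<le> QEC G"
proof -
  let ?V = "pverts G"
  let ?q = "\<lambda>f. inner_on ?V f (dist_matrix_apply G f)"
  let ?S = "{f. (\<forall>i. i \<notin> ?V \<longrightarrow> f i = 0) \<and> inner_on ?V f f = 1 \<and> inner_on ?V (\<lambda>_. 1) f = 0}"
  \<comment> \<open>Values off \<open>?V\<close> do not influence the form, but compactness needs them to be fixed.\<close>
  define cut where "cut f i = (if i \<in> ?V then f i else 0)" for f :: "'a \<Rightarrow> real" and i
  have cut_q: "?q (cut f) = ?q f" for f
    by (auto simp: inner_on_def dist_matrix_apply_def cut_def intro!: sum.cong)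
  have cut_S: "cut f \<in> ?S" if "inner_on ?V f f = 1" "inner_on ?V (\<lambda>_. 1) f = 0" for f
    using that by (auto simp: inner_on_def cut_def)
  have "?S \<noteq> {}"
    using cut_S[OF norm sum0] by blast
  then have "\<exists>m\<in>?S. \<forall>f\<in>?S. ?q f \<le> ?q m"
    by (rule continuous_attains_sup[OF compact_unit_sphere_sum_zero[OF fin] _
          continuous_on_dist_form])
  then obtain m where m: "m \<in> ?S" and max: "\<forall>f\<in>?S. ?q f \<le> ?q m"
    by (rule bexE)
  have le: "?q f \<le> ?q m" if "inner_on ?V f f = 1" "inner_on ?V (\<lambda>_. 1) f = 0" for f
    using bspec[OF max cut_S[OF that]] by (simp only: cut_q)
  have "QEC G = ?q m"
    unfolding QEC_def using m le by (intro Greatest_equality) auto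
  with le[OF norm sum0] show ?thesis
    by simp
qed

lemma QEC_rayleigh_bound:
  assumes fin: "finite (pverts G)"
    and nz: "inner_on (pverts G) h h > 0"
    and sum0: "inner_on (pverts G) (\<lambda>_. 1) h = 0"
  shows "inner_on (pverts G) h (dist_matrix_apply G h) \<le> QEC G * inner_on (pverts G) h h"
proof -
  let ?V = "pverts G"
  define c where "c = sqrt (inner_on ?V h h)"
  have c: "c > 0" "c * c = inner_on ?V h h"
    using nz by (auto simp: c_def)
  define g where "g i = h i / c" for i
  have "inner_on ?V g g = inner_on ?V h h / (c * c)"
    by (simp add: inner_on_def g_def sum_divide_distrib)
  then have "inner_on ?V g g = 1"
    using c nz by simp
  moreover have "inner_on ?V (\<lambda>_. 1) g = 0"
    using sum0 by (simp add: inner_on_def g_def flip: sum_divide_distrib)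
  ultimately have "inner_on ?V g (dist_matrix_apply G g) \<le> QEC G"
    by (rule QEC_upper_bound[OF fin])
  moreover have "inner_on ?V g (dist_matrix_apply G g) =
      inner_on ?V h (dist_matrix_apply G h) / (c * c)"
    by (simp add: inner_on_def dist_matrix_apply_def g_def sum_divide_distrib sum_distrib_left)
  ultimately show ?thesis
    using c nz by (simp add: field_simps)
qed

section \<open>Distances at most two\<close>

context pair_wf_digraph
begin

lemma graph_dist_eq_length:
  assumes "awalk u p v" and "\<And>q. awalk u q v \<Longrightarrow> length p \<le> length q"
  shows "graph_dist G u v = length p"
proof -
  have cost: "awalk_cost (\<lambda>_. 1) q = real (length q)" for q :: "('a \<times> 'a) list"
    by (induction q) auto
  have "\<mu> (\<lambda>_. 1) u v = ereal (length p)"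
    unfolding \<mu>_def cost
    using assms by (intro antisym INF_lower2[of p] INF_greatest) auto
  then show ?thesis
    by (simp add: graph_dist_def)
qed

lemma graph_dist_self: "u \<in> pverts G \<Longrightarrow> graph_dist G u u = 0"
  using graph_dist_eq_length[of u "[]" u] by (simp add: awalk_Nil_iff)

lemma graph_dist_adjacent:
  assumes "(u, v) \<in> parcs G" "u \<noteq> v"
  shows "graph_dist G u v = 1"
proof -
  have "awalk u [(u, v)] v"
    using assms by (auto simp: awalk_Cons_iff awalk_Nil_iff in_arcsD2)
  moreover have "1 \<le> length q" if "awalk u q v" for q
    using that assms by (cases q) (auto simp: awalk_Nil_iff)
  ultimately show ?thesis
    using graph_dist_eq_length[of u "[(u, v)]" v] by simp
qed

lemma graph_dist_common_neighbour:
  assumes "(u, w) \<in> parcs G" "(w, v) \<in> parcs G" "u \<noteq> v" "(u, v) \<notin> parcs G"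
  shows "graph_dist G u v = 2"
proof -
  have "awalk u [(u, w), (w, v)] v"
    using assms by (auto simp: awalk_Cons_iff awalk_Nil_iff in_arcsD2)
  moreover have "2 \<le> length q" if "awalk u q v" for q
  proof (rule ccontr)
    assume "\<not> 2 \<le> length q"
    then consider "q = []" | e where "q = [e]"
      by (cases q; cases "tl q") auto
    then show False
      using that assms by cases (auto simp: awalk_Nil_iff awalk_Cons_iff)
  qed
  ultimately show ?thesis
    using graph_dist_eq_length[of u "[(u, w), (w, v)]" v] by (simp add: numeral_2_eq_2)
qed

end

section \<open>Test functions supported on an induced subgraph\<close>

text \<open>
  Turns the isomorphism of digraphs, which carries separate maps on vertices and on arcs, into a
  bijection of vertex sets that preserves and reflects adjacency.
\<close>

lemma has_induced_copyE:
  assumes "has_induced_copy G H"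
  obtains S \<psi> where "S \<subseteq> pverts G" "bij_betw \<psi> S (pverts H)"
    "\<And>u v. u \<in> S \<Longrightarrow> v \<in> S \<Longrightarrow> (u, v) \<in> parcs G \<longleftrightarrow> (\<psi> u, \<psi> v) \<in> parcs H"
proof -
  from assms obtain K iso where K: "induced_subgraph K (with_proj G)"
    and iso: "pre_digraph.digraph_isomorphism K iso" and H: "with_proj H = app_iso iso K"
    unfolding has_induced_copy_def digraph_iso_def by blast
  have sub: "verts K \<subseteq> pverts G" and ends: "tail K = fst" "head K = snd"
    and arcs_K: "arcs K = {e \<in> parcs G. fst e \<in> verts K \<and> snd e \<in> verts K}"
    using K by (auto simp: induced_subgraph_def subgraph_def compatible_def)
  have wf: "wf_digraph K"
    using K by (simp add: induced_subgraph_def subgraph_def)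
  have inj: "inj_on (iso_verts iso) (verts K)"
    using iso by (rule pre_digraph.digraph_isomorphism_inj_on_verts)
  have verts_H: "pverts H = iso_verts iso ` verts K"
    using arg_cong[OF H, of verts] by simp
  have parcs_H: "parcs H = (\<lambda>(u, v). (iso_verts iso u, iso_verts iso v)) ` arcs K"
    using arg_cong[OF H, of arcs_ends] wf_digraph.arcs_ends_app_iso_eq[OF wf iso]
    by (simp add: arcs_ends_conv ends)
  show thesis
  proof (rule that[of "verts K" "iso_verts iso"])
    show "bij_betw (iso_verts iso) (verts K) (pverts H)"
      using inj verts_H by (simp add: bij_betw_def)
    show "(u, v) \<in> parcs G \<longleftrightarrow> (iso_verts iso u, iso_verts iso v) \<in> parcs H"
      if "u \<in> verts K" "v \<in> verts K" for u v
      using that by (auto simp: parcs_H arcs_K inj_on_eq_iff[OF inj])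
  qed (fact sub)
qed

text \<open>
  The left-hand side is \<open>\<langle>x,Dx\<rangle>\<close> for the distance matrix \<open>D = 2J - 2I - A\<close> of \<open>H\<close>. The assumption
  \<open>diam\<close> makes \<open>D\<close> also the restriction of the distance matrix of \<open>G\<close> to the copy of \<open>H\<close>, so that
  \<open>x\<close>, transported to the copy and extended by zero, is a test function for \<open>QEC(G)\<close>.
\<close>

lemma QEC_ge_of_induced_diameter_two:
  fixes x :: "'b \<Rightarrow> real"
  assumes G: "pair_graph G" and copy: "has_induced_copy G H"
    and diam: "\<And>a b. a \<in> pverts H \<Longrightarrow> b \<in> pverts H \<Longrightarrow> a \<noteq> b \<Longrightarrow> (a, b) \<notin> parcs H \<Longrightarrow>
                 \<exists>c\<in>pverts H. (a, c) \<in> parcs H \<and> (c, b) \<in> parcs H"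
    and nz: "(\<Sum>a\<in>pverts H. (x a)\<^sup>2) > 0"
    and sum0: "(\<Sum>a\<in>pverts H. x a) = 0"
  shows "- 2 * (\<Sum>a\<in>pverts H. (x a)\<^sup>2) -
           (\<Sum>a\<in>pverts H. \<Sum>b\<in>pverts H. if (a, b) \<in> parcs H then x a * x b else 0)
         \<le> QEC G * (\<Sum>a\<in>pverts H. (x a)\<^sup>2)"
proof -
  interpret pair_graph G by (fact G)
  obtain S \<psi> where S: "S \<subseteq> pverts G" and bij: "bij_betw \<psi> S (pverts H)"
    and adj: "\<And>u v. u \<in> S \<Longrightarrow> v \<in> S \<Longrightarrow> (u, v) \<in> parcs G \<longleftrightarrow> (\<psi> u, \<psi> v) \<in> parcs H"
    using copy by (rule has_induced_copyE) blast
  have fin: "finite (pverts G)" and fin_S: "finite S"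
    using pair_finite_verts finite_subset[OF S] by auto
  have fin_H: "finite (pverts H)"
    using bij fin_S bij_betw_finite by blast
  have \<psi>_in: "\<psi> u \<in> pverts H" if "u \<in> S" for u
    using bij that by (rule bij_betwE[rule_format])
  \<comment> \<open>the matrix identity \<open>D = 2J - A - 2I\<close>, entry by entry\<close>
  have dist: "graph_dist G u v =
      2 - (if (\<psi> u, \<psi> v) \<in> parcs H then 1 else 0) - 2 * (if \<psi> u = \<psi> v then 1 else 0)"
    if "u \<in> S" "v \<in> S" for u v
  proof -
    have eq: "\<psi> u = \<psi> v \<longleftrightarrow> u = v"
      using bij that by (auto simp: bij_betw_def dest: inj_onD)
    consider "u = v" | "u \<noteq> v" "(u, v) \<in> parcs G" | "u \<noteq> v" "(u, v) \<notin> parcs G"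
      by blast
    then show ?thesis
    proof cases
      case 1
      moreover have "(u, u) \<notin> parcs G"
        using pair_no_loops by fastforce
      ultimately show ?thesis
        using that S adj graph_dist_self by auto
    next
      case 2
      then show ?thesis
        using that adj eq graph_dist_adjacent by auto
    next
      case 3
      then have "\<exists>c\<in>pverts H. (\<psi> u, c) \<in> parcs H \<and> (c, \<psi> v) \<in> parcs H"
        using that adj eq \<psi>_in by (intro diam) auto
      then obtain c where c: "c \<in> pverts H" "(\<psi> u, c) \<in> parcs H" "(c, \<psi> v) \<in> parcs H"
        by blast
      then obtain w where w: "w \<in> S" "c = \<psi> w"
        using bij_betw_imp_surj_on[OF bij] by force
      then have "graph_dist G u v = 2"
        using 3 that adj c by (intro graph_dist_common_neighbour[of u w v]) auto
      then show ?thesis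
        using 3 that adj eq by simp
    qed
  qed
  define h where "h u = (if u \<in> S then x (\<psi> u) else 0)" for u
  have to_S: "(\<Sum>u\<in>pverts G. h u * k u) = (\<Sum>u\<in>S. x (\<psi> u) * k u)" for k :: "'a \<Rightarrow> real"
    using S fin by (intro sum.mono_neutral_cong_right) (auto simp: h_def)
  have to_H: "(\<Sum>u\<in>S. k (\<psi> u)) = (\<Sum>a\<in>pverts H. k a)" for k :: "'b \<Rightarrow> real"
    using bij by (rule sum.reindex_bij_betw)
  have to_H2: "(\<Sum>u\<in>S. \<Sum>v\<in>S. k (\<psi> u) (\<psi> v)) = (\<Sum>a\<in>pverts H. \<Sum>b\<in>pverts H. k a b)"
    for k :: "'b \<Rightarrow> 'b \<Rightarrow> real"
    using to_H[of "\<lambda>a. \<Sum>b\<in>pverts H. k a b"] by (simp only: to_H[of "k _"])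
  have norm: "inner_on (pverts G) h h = (\<Sum>a\<in>pverts H. (x a)\<^sup>2)"
  proof -
    have "inner_on (pverts G) h h = (\<Sum>u\<in>S. x (\<psi> u) * h u)"
      unfolding inner_on_def by (rule to_S)
    also have "\<dots> = (\<Sum>u\<in>S. (x (\<psi> u))\<^sup>2)"
      by (intro sum.cong) (auto simp: h_def power2_eq_square)
    also have "\<dots> = (\<Sum>a\<in>pverts H. (x a)\<^sup>2)"
      by (rule to_H)
    finally show ?thesis .
  qed
  have ortho: "inner_on (pverts G) (\<lambda>_. 1) h = 0"
    using to_S[of "\<lambda>_. 1"] to_H[of x] sum0 by (simp add: inner_on_def)
  have "inner_on (pverts G) h (dist_matrix_apply G h) =
      (\<Sum>u\<in>S. \<Sum>v\<in>S. x (\<psi> u) * x (\<psi> v) * graph_dist G u v)"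
  proof -
    have "dist_matrix_apply G h u = (\<Sum>v\<in>S. x (\<psi> v) * graph_dist G u v)" for u
      using to_S[of "graph_dist G u"] by (simp add: dist_matrix_apply_def mult.commute)
    then have "inner_on (pverts G) h (dist_matrix_apply G h) =
        (\<Sum>u\<in>S. x (\<psi> u) * (\<Sum>v\<in>S. x (\<psi> v) * graph_dist G u v))"
      by (simp only: inner_on_def to_S)
    then show ?thesis
      by (simp add: sum_distrib_left mult.assoc)
  qed
  also have "\<dots> = (\<Sum>u\<in>S. \<Sum>v\<in>S. x (\<psi> u) * x (\<psi> v) *
      (2 - (if (\<psi> u, \<psi> v) \<in> parcs H then 1 else 0) - 2 * (if \<psi> u = \<psi> v then 1 else 0)))"
    using dist by (intro sum.cong) auto
  also have "\<dots> = (\<Sum>a\<in>pverts H. \<Sum>b\<in>pverts H. x a * x b *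
      (2 - (if (a, b) \<in> parcs H then 1 else 0) - 2 * (if a = b then 1 else 0)))"
    by (rule to_H2)
  also have "\<dots> = (\<Sum>a\<in>pverts H. \<Sum>b\<in>pverts H.
      2 * (x a * x b) - (if (a, b) \<in> parcs H then x a * x b else 0) -
      (if a = b then 2 * (x a)\<^sup>2 else 0))"
    by (intro sum.cong) (auto simp: power2_eq_square algebra_simps)
  also have "\<dots> = (\<Sum>a\<in>pverts H. \<Sum>b\<in>pverts H. 2 * (x a * x b)) -
      (\<Sum>a\<in>pverts H. \<Sum>b\<in>pverts H. if (a, b) \<in> parcs H then x a * x b else 0) -
      2 * (\<Sum>a\<in>pverts H. (x a)\<^sup>2)"
    using fin_H by (simp add: sum_subtractf sum_distrib_left)
  also have "(\<Sum>a\<in>pverts H. \<Sum>b\<in>pverts H. 2 * (x a * x b)) = 0"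
    using sum0 by (simp flip: sum_distrib_left)
  finally show ?thesis
    using QEC_rayleigh_bound[OF fin, of h] nz norm ortho sum0 by simp
qed

lemma graph_free_if_QEC_less:
  fixes x :: "'b \<Rightarrow> real"
  assumes "pair_graph G" and "QEC G < - 1 / 2"
    and diam: "\<forall>a\<in>pverts H. \<forall>b\<in>pverts H. a \<noteq> b \<longrightarrow> (a, b) \<notin> parcs H \<longrightarrow>
                 (\<exists>c\<in>pverts H. (a, c) \<in> parcs H \<and> (c, b) \<in> parcs H)"
    and nz: "(\<Sum>a\<in>pverts H. (x a)\<^sup>2) > 0"
    and sum0: "(\<Sum>a\<in>pverts H. x a) = 0"
    and form: "2 * (\<Sum>a\<in>pverts H. \<Sum>b\<in>pverts H. if (a, b) \<in> parcs H then x a * x b else 0)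
                 \<le> - 3 * (\<Sum>a\<in>pverts H. (x a)\<^sup>2)"
  shows "graph_free H G"
  unfolding graph_free_def
proof
  assume copy: "has_induced_copy G H"
  let ?n = "\<Sum>a\<in>pverts H. (x a)\<^sup>2"
  have "- 2 * ?n - (\<Sum>a\<in>pverts H. \<Sum>b\<in>pverts H. if (a, b) \<in> parcs H then x a * x b else 0)
      \<le> QEC G * ?n"
    using diam by (intro QEC_ge_of_induced_diameter_two[OF assms(1) copy _ nz sum0]) blast
  then have "- 1 / 2 * ?n \<le> QEC G * ?n"
    using form by simp
  moreover have "QEC G * ?n < - 1 / 2 * ?n"
    using assms(2) nz by (rule mult_strict_right_mono)
  ultimately show False
    by simp
qed

section \<open>The four forbidden subgraphs\<close>

text \<open>
  Adjacency is described by arithmetic conditions rather than by listing the arcs, so that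
  simplification decides it for numerals.
\<close>

lemma pverts_forbidden:
  "pverts diamond = {0, 1, 2, 3}" "pverts claw = {0, 1, 2, 3}"
  "pverts (cycle_graph 4) = {0, 1, 2, 3}" "pverts (cycle_graph 5) = {0, 1, 2, 3, 4}"
  unfolding diamond_def complete_graph_def claw_def complete_bipartite_graph_def cycle_graph_def
  by auto

lemma parcs_diamond_iff:
  "(a, b) \<in> parcs diamond \<longleftrightarrow>
     a < 4 \<and> b < 4 \<and> a \<noteq> b \<and> (a, b) \<noteq> (0, 1) \<and> (a, b) \<noteq> (1, 0)"
  by (simp add: diamond_def complete_graph_def)

lemma parcs_claw_iff:
  "(a, b) \<in> parcs claw \<longleftrightarrow> a < 1 \<and> 1 \<le> b \<and> b < 4 \<or> 1 \<le> a \<and> a < 4 \<and> b < 1"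
  by (simp add: claw_def complete_bipartite_graph_def)

lemma parcs_cycle_graph_iff:
  "(a, b) \<in> parcs (cycle_graph n) \<longleftrightarrow> a < n \<and> b = Suc a mod n \<or> b < n \<and> a = Suc b mod n"
  unfolding cycle_graph_def by (simp only: pair_pre_digraph.simps UN_iff) blast

theorem corollary4p4:
  fixes G :: "'a pair_pre_digraph"
  assumes "pair_graph G"
    and "Digraph_Component.connected (with_proj G)"
    and "card (pverts G) \<ge> 2"
    and "QEC G < - 1 / 2"
  shows "graph_free diamond G \<and> graph_free claw G \<and>
         graph_free (cycle_graph 4) G \<and> graph_free (cycle_graph 5) G"
proof (intro conjI)
  note free = graph_free_if_QEC_less[OF assms(1,4)]
  \<comment> \<open>In \<^const>\<open>diamond\<close> the missing edge joins \<open>0\<close> and \<open>1\<close>. This vector and the one for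
    \<^const>\<open>claw\<close>, with centre \<open>0\<close>, give the value \<open>-1/2\<close> exactly.\<close>
  show "graph_free diamond G"
    by (rule free[where x = "(!) [1, 1, -1, -1]"]) (simp_all add: pverts_forbidden parcs_diamond_iff)
  show "graph_free claw G"
    by (rule free[where x = "(!) [3, -1, -1, -1]"]) (simp_all add: pverts_forbidden parcs_claw_iff)
  \<comment> \<open>The alternating vector is an eigenvector of the adjacency matrix for the eigenvalue \<open>-2\<close>.\<close>
  show "graph_free (cycle_graph 4) G"
    by (rule free[where x = "(!) [1, -1, 1, -1]"]) (simp_all add: pverts_forbidden parcs_cycle_graph_iff)
  \<comment> \<open>An integer approximation to the eigenvector \<open>cos (4 * pi * k / 5)\<close> for the least adjacency
    eigenvalue \<open>- (1 + sqrt 5) / 2\<close>, which is about \<open>-1.62\<close>. The vector has adjacency quotient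
    \<open>-22/14\<close>, which is still below \<open>-3/2\<close>.\<close>
  show "graph_free (cycle_graph 5) G"
    by (rule free[where x = "(!) [2, -2, 1, 1, -2]"]) (simp_all add: pverts_forbidden parcs_cycle_graph_iff)
qed

end
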